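(* Let $v,m$ be integers with $1\le m\le v/2$, let $A$ be the adjacency matrix of the Johnson graph $J(v,m)$, and let $r\in\mathbb N^+$. PST under $A^r$ between distinct vertices occurs if and only if one of the following holds. (i) $J(v,m)=J(2,1)=K_2$ and the exponent $r$ is odd; in this case the minimum positive transfer time is $\pi/2$. (ii) $J(v,m)=J(6,3)$, the exponent $r$ is even, and the two vertices are complementary $3$-subsets; in this case the minimum positive transfer time is \[ \frac{\pi}{3^r-1}. \]
   Context: $\mathbb N^+=\{1,2,3,\ldots\}$. The vertices of $J(v,m)$ are the $m$-subsets of a fixed $v$-element set; two vertices are adjacent when their intersection has size $m-1$. A real symmetric matrix $K$ indexed by a finite vertex set has perfect state transfer (PST) from vertex $a$ to vertex $b$ at time $\tau>0$ (a transfer time) if $\exp(-\mathrm i\tau K)e_a=\gamma e_b$ for some $\gamma\in\mathbb C$ with $|\gamma|=1$, where $e_x$ is the standard basis vector indexed by $x$; PST under $K$ between $a$ and $b$ occurs if this holds for some $\tau>0$. *)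

theory Defs
  imports Complex_Main
begin

text \<open>Matrices indexed by a finite set \<open>V\<close> are functions of two arguments; only their values on
  \<open>V \<times> V\<close> are meaningful. Likewise vectors are functions, meaningful on \<open>V\<close> only.\<close>

definition fin_mat_id :: "'i \<Rightarrow> 'i \<Rightarrow> 'k::semiring_1" where
  "fin_mat_id x y = (if x = y then 1 else 0)"

definition fin_mat_mult ::
    "'i set \<Rightarrow> ('i \<Rightarrow> 'i \<Rightarrow> 'k::semiring_1) \<Rightarrow> ('i \<Rightarrow> 'i \<Rightarrow> 'k) \<Rightarrow> 'i \<Rightarrow> 'i \<Rightarrow> 'k" where
  "fin_mat_mult V M N x y = (\<Sum>z\<in>V. M x z * N z y)"

primrec fin_mat_pow ::
    "'i set \<Rightarrow> ('i \<Rightarrow> 'i \<Rightarrow> 'k::semiring_1) \<Rightarrow> nat \<Rightarrow> 'i \<Rightarrow> 'i \<Rightarrow> 'k" where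
  "fin_mat_pow V M 0 = fin_mat_id"
| "fin_mat_pow V M (Suc n) = fin_mat_mult V M (fin_mat_pow V M n)"

text \<open>For finite \<open>V\<close> the entrywise exponential series converges for every \<open>M\<close>.\<close>

definition fin_mat_exp :: "'i set \<Rightarrow> ('i \<Rightarrow> 'i \<Rightarrow> complex) \<Rightarrow> 'i \<Rightarrow> 'i \<Rightarrow> complex" where
  "fin_mat_exp V M x y = (\<Sum>n. fin_mat_pow V M n x y / fact n)"

definition fin_mat_vec ::
    "'i set \<Rightarrow> ('i \<Rightarrow> 'i \<Rightarrow> 'k::semiring_1) \<Rightarrow> ('i \<Rightarrow> 'k) \<Rightarrow> 'i \<Rightarrow> 'k" where
  "fin_mat_vec V M u x = (\<Sum>y\<in>V. M x y * u y)"

definition basis_vec :: "'i \<Rightarrow> 'i \<Rightarrow> 'k::semiring_1" where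
  "basis_vec a x = (if x = a then 1 else 0)"

text \<open>Perfect state transfer is only considered for \<open>K\<close> symmetric on \<open>V \<times> V\<close> and \<open>a, b \<in> V\<close>.\<close>

definition pst_at :: "'i set \<Rightarrow> ('i \<Rightarrow> 'i \<Rightarrow> real) \<Rightarrow> 'i \<Rightarrow> 'i \<Rightarrow> real \<Rightarrow> bool" where
  "pst_at V K a b \<tau> \<longleftrightarrow> \<tau> > 0 \<and>
     (\<exists>\<gamma>::complex. norm \<gamma> = 1 \<and>
       (\<forall>x\<in>V. fin_mat_vec V
                 (fin_mat_exp V (\<lambda>x y. - \<i> * complex_of_real \<tau> * complex_of_real (K x y)))
                 (basis_vec a) x
               = \<gamma> * basis_vec b x))"

definition pst :: "'i set \<Rightarrow> ('i \<Rightarrow> 'i \<Rightarrow> real) \<Rightarrow> 'i \<Rightarrow> 'i \<Rightarrow> bool" where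
  "pst V K a b \<longleftrightarrow> (\<exists>\<tau>. pst_at V K a b \<tau>)"

definition is_min_transfer_time ::
    "'i set \<Rightarrow> ('i \<Rightarrow> 'i \<Rightarrow> real) \<Rightarrow> 'i \<Rightarrow> 'i \<Rightarrow> real \<Rightarrow> bool" where
  "is_min_transfer_time V K a b \<tau> \<longleftrightarrow>
     pst_at V K a b \<tau> \<and> (\<forall>t. pst_at V K a b t \<longrightarrow> \<tau> \<le> t)"

definition johnson_verts :: "'a set \<Rightarrow> nat \<Rightarrow> 'a set set" where
  "johnson_verts S m = {X. X \<subseteq> S \<and> card X = m}"

text \<open>Written additively because subtraction on \<^typ>\<open>nat\<close> truncates.\<close>

definition johnson_adj :: "nat \<Rightarrow> 'a set \<Rightarrow> 'a set \<Rightarrow> bool" where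
  "johnson_adj m X Y \<longleftrightarrow> card (X \<inter> Y) + 1 = m"

definition johnson_matrix :: "nat \<Rightarrow> 'a set \<Rightarrow> 'a set \<Rightarrow> real" where
  "johnson_matrix m X Y = (if johnson_adj m X Y then 1 else 0)"

lemma johnson_1_complete:
  assumes "X \<in> johnson_verts S 1" "Y \<in> johnson_verts S 1"
  shows "johnson_adj 1 X Y \<longleftrightarrow> X \<noteq> Y"
  using assms by (auto simp: johnson_verts_def johnson_adj_def card_1_singleton_iff)

lemma fin_mat_pow_Suc_right:
  assumes "finite V" "x \<in> V" "y \<in> V"
  shows "fin_mat_pow V M (Suc n) x y = (\<Sum>z\<in>V. fin_mat_pow V M n x z * M z y)"
  using assms(2)
proof (induction n arbitrary: x)
  case 0
  then show ?case
    using assms by (simp add: fin_mat_mult_def fin_mat_id_def if_distrib if_distribR cong: if_cong)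
next
  case (Suc n)
  have "fin_mat_pow V M (Suc (Suc n)) x y = (\<Sum>w\<in>V. M x w * fin_mat_pow V M (Suc n) w y)"
    by (simp add: fin_mat_mult_def)
  also have "\<dots> = (\<Sum>w\<in>V. M x w * (\<Sum>z\<in>V. fin_mat_pow V M n w z * M z y))"
    using Suc.IH by (intro sum.cong) auto
  also have "\<dots> = (\<Sum>z\<in>V. fin_mat_pow V M (Suc n) x z * M z y)"
    by (simp add: fin_mat_mult_def sum_distrib_left sum_distrib_right mult.assoc)
       (rule sum.swap)
  finally show ?case .
qed

lemma johnson_matrix_pow_sym:
  assumes "finite S" "X \<in> johnson_verts S m" "Y \<in> johnson_verts S m"
  shows "fin_mat_pow (johnson_verts S m) (johnson_matrix m) n X Y
       = fin_mat_pow (johnson_verts S m) (johnson_matrix m) n Y X"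
  using assms(2,3)
proof (induction n arbitrary: X Y)
  case 0
  then show ?case by (simp add: fin_mat_id_def)
next
  case (Suc n)
  have fin: "finite (johnson_verts S m)"
    using assms(1) by (simp add: johnson_verts_def)
  have sym: "johnson_matrix m U W = johnson_matrix m W U" for U W :: "'a set"
    by (simp add: johnson_matrix_def johnson_adj_def Int_commute)
  have "fin_mat_pow (johnson_verts S m) (johnson_matrix m) (Suc n) X Y
      = (\<Sum>Z\<in>johnson_verts S m. johnson_matrix m X Z
           * fin_mat_pow (johnson_verts S m) (johnson_matrix m) n Z Y)"
    by (simp add: fin_mat_mult_def)
  also have "\<dots> = (\<Sum>Z\<in>johnson_verts S m.
      fin_mat_pow (johnson_verts S m) (johnson_matrix m) n Y Z * johnson_matrix m Z X)"
    using Suc by (intro sum.cong) (auto simp: sym[of X] mult.commute)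
  also have "\<dots> = fin_mat_pow (johnson_verts S m) (johnson_matrix m) (Suc n) Y X"
    by (rule fin_mat_pow_Suc_right[OF fin Suc.prems(2,1), symmetric])
  finally show ?case .
qed

end

theory Submission
  imports Defs "HOL-Combinatorics.Transposition"
begin

text \<open>The stabiliser of \<open>a\<close> in the symmetric group fixes \<open>exp (-i\<tau>A\<^sup>r) e\<^sub>a\<close>, so \<open>b\<close> is a union of its
  orbits \<open>a\<close> and \<open>S - a\<close>; hence \<open>b = S - a\<close> and \<open>v = 2m\<close>. Complementation acts by \<open>(-1)\<^sup>j\<close> on the
  eigenspace of \<open>\<theta>\<^sub>j = (m - j)\<^sup>2 - j\<close>, so transfer at time \<open>\<tau>\<close> forces \<open>\<tau>(\<theta>\<^sub>0\<^sup>r - \<theta>\<^sub>j\<^sup>r)\<close> to be an integer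
  multiple of \<open>\<pi>\<close> of the parity of \<open>j\<close>. Comparing powers of 2 in two of these conditions
  excludes \<open>m \<ge> 2\<close> except for \<open>m = 3\<close> with \<open>r\<close> even: \<open>j = 1, 2\<close> settle even \<open>m\<close> and odd \<open>r\<close>, and
  \<open>j = 1, 4\<close> settle odd \<open>m \<ge> 5\<close> with \<open>r\<close> even. For \<open>m = 1\<close> and \<open>m = 3\<close> the basis vector expands in
  eigenfunctions of degree at most \<open>m\<close>, so the conditions are also sufficient and can be solved.\<close>

section \<open>Matrices indexed by a finite set\<close>

lemma fin_mat_pow_scale:
  fixes K :: "'i \<Rightarrow> 'i \<Rightarrow> 'k::comm_semiring_1"
  shows "fin_mat_pow V (\<lambda>x y. c * K x y) n x y = c ^ n * fin_mat_pow V K n x y"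
proof (induction n arbitrary: x)
  case (Suc n)
  then show ?case
    by (simp add: fin_mat_mult_def sum_distrib_left mult.assoc mult.left_commute)
qed simp

text \<open>By induction on \<open>n\<close>, reindexing the inner sum along \<open>s\<close>. For
  the action of a transposition on subsets it serves twice: to pass from the adjacency matrix to its
  power, and from that power to the terms of the exponential series.\<close>

lemma fin_mat_pow_invariant:
  assumes "bij_betw s V V" and "\<And>x y. x \<in> V \<Longrightarrow> y \<in> V \<Longrightarrow> K (s x) (s y) = K x y"
    and "x \<in> V" "y \<in> V"
  shows "fin_mat_pow V K n (s x) (s y) = fin_mat_pow V K n x y"
  using assms(3)
proof (induction n arbitrary: x)
  case 0
  have "s x = s y \<longleftrightarrow> x = y"
    using assms 0 by (metis bij_betw_imp_inj_on inj_onD)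
  then show ?case by (simp add: fin_mat_id_def)
next
  case (Suc n)
  have "fin_mat_pow V K (Suc n) (s x) (s y) = (\<Sum>z\<in>V. K (s x) z * fin_mat_pow V K n z (s y))"
    by (simp add: fin_mat_mult_def)
  also have "\<dots> = (\<Sum>z\<in>V. K (s x) (s z) * fin_mat_pow V K n (s z) (s y))"
    by (rule sum.reindex_bij_betw[OF assms(1), symmetric])
  also have "\<dots> = (\<Sum>z\<in>V. K x z * fin_mat_pow V K n z y)"
    using Suc assms by (intro sum.cong) auto
  finally show ?case by (simp add: fin_mat_mult_def)
qed

text \<open>Left eigenvectors are used because a column of the exponential is what transfer
  prescribes: pairing \<open>f\<close> with that column isolates a single eigenvalue, so no spectral
  decomposition is required.\<close>

lemma fin_mat_pow_left_eigenvector: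
  fixes f :: "'i \<Rightarrow> 'k::comm_semiring_1"
  assumes "finite V" and ev: "\<And>y. y \<in> V \<Longrightarrow> (\<Sum>x\<in>V. f x * K x y) = c * f y" and "y \<in> V"
  shows "(\<Sum>x\<in>V. f x * fin_mat_pow V K n x y) = c ^ n * f y"
proof (induction n)
  case 0
  have "(\<Sum>x\<in>V. f x * fin_mat_id x y) = (\<Sum>x\<in>V. if x = y then f x else 0)"
    by (intro sum.cong) (auto simp: fin_mat_id_def)
  also have "\<dots> = f y"
    using assms(1,3) by simp
  finally show ?case by simp
next
  case (Suc n)
  have "(\<Sum>x\<in>V. f x * fin_mat_pow V K (Suc n) x y)
      = (\<Sum>z\<in>V. (\<Sum>x\<in>V. f x * K x z) * fin_mat_pow V K n z y)"
    by (simp add: fin_mat_mult_def sum_distrib_left sum_distrib_right mult.assoc)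
       (rule sum.swap)
  also have "\<dots> = c * (\<Sum>z\<in>V. f z * fin_mat_pow V K n z y)"
    by (simp add: ev sum_distrib_left mult.assoc cong: sum.cong)
  finally show ?case by (simp add: Suc mult.assoc)
qed

lemma fin_mat_pow_norm_le:
  fixes M :: "'i \<Rightarrow> 'i \<Rightarrow> 'k::real_normed_algebra_1"
  assumes "finite V" and "\<And>x y. x \<in> V \<Longrightarrow> y \<in> V \<Longrightarrow> norm (M x y) \<le> B" and "0 \<le> B"
    and "x \<in> V" "y \<in> V"
  shows "norm (fin_mat_pow V M n x y) \<le> (of_nat (card V) * B) ^ n"
  using assms(4)
proof (induction n arbitrary: x)
  case 0
  then show ?case by (simp add: fin_mat_id_def)
next
  case (Suc n)
  have "norm (fin_mat_pow V M (Suc n) x y) \<le> (\<Sum>z\<in>V. B * (of_nat (card V) * B) ^ n)"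
    unfolding fin_mat_pow.simps fin_mat_mult_def
  proof (rule sum_norm_le)
    fix z assume "z \<in> V"
    then have "norm (M x z) * norm (fin_mat_pow V M n z y) \<le> B * (of_nat (card V) * B) ^ n"
      using Suc assms by (intro mult_mono) auto
    then show "norm (M x z * fin_mat_pow V M n z y) \<le> B * (of_nat (card V) * B) ^ n"
      using norm_mult_ineq order_trans by blast
  qed
  then show ?case by (simp add: mult.assoc)
qed

text \<open>Comparison with the real exponential series at \<open>card V * B\<close>, where
  \<open>B\<close>, the sum of all entry norms, bounds every single entry.\<close>

lemma fin_mat_exp_summable:
  assumes "finite V" "x \<in> V" "y \<in> V"
  shows "summable (\<lambda>n. fin_mat_pow V M n x y / (fact n :: complex))"
proof -
  define B where "B = (\<Sum>x\<in>V. \<Sum>y\<in>V. norm (M x y))"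
  have B: "norm (M u w) \<le> B" if "u \<in> V" "w \<in> V" for u w
  proof -
    have "norm (M u w) \<le> (\<Sum>y\<in>V. norm (M u y))"
      using that assms by (intro member_le_sum) auto
    also have "\<dots> \<le> B"
      unfolding B_def using that assms
      by (intro member_le_sum[where f = "\<lambda>u. \<Sum>y\<in>V. norm (M u y)"]) (auto intro: sum_nonneg)
    finally show ?thesis .
  qed
  have "0 \<le> B" unfolding B_def by (intro sum_nonneg) auto
  have "summable (\<lambda>n. (of_nat (card V) * B) ^ n /\<^sub>R fact n)"
    by (rule summable_exp_generic)
  then show ?thesis
  proof (rule summable_comparison_test'[where N = 0])
    fix n :: nat
    show "norm (fin_mat_pow V M n x y / (fact n :: complex)) \<le> (of_nat (card V) * B) ^ n /\<^sub>R fact n"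
      using fin_mat_pow_norm_le[where M = M and n = n, OF assms(1) B \<open>0 \<le> B\<close> assms(2,3)]
      by (simp add: norm_divide divide_inverse_commute[symmetric] divide_right_mono)
  qed
qed

lemma fin_mat_exp_left_eigenvector:
  assumes "finite V" and "\<And>y. y \<in> V \<Longrightarrow> (\<Sum>x\<in>V. f x * M x y) = c * f y" and "y \<in> V"
  shows "(\<Sum>x\<in>V. f x * fin_mat_exp V M x y) = exp c * f y"
proof -
  have sm: "summable (\<lambda>n. f x * (fin_mat_pow V M n x y / fact n))" if "x \<in> V" for x
    using fin_mat_exp_summable[OF assms(1) that assms(3)] by (rule summable_mult)
  have "(\<Sum>x\<in>V. f x * fin_mat_exp V M x y) = (\<Sum>x\<in>V. \<Sum>n. f x * (fin_mat_pow V M n x y / fact n))"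
    unfolding fin_mat_exp_def
    using fin_mat_exp_summable[OF assms(1) _ assms(3)]
    by (intro sum.cong refl suminf_mult[symmetric]) auto
  also have "\<dots> = (\<Sum>n. \<Sum>x\<in>V. f x * (fin_mat_pow V M n x y / fact n))"
    using sm by (intro suminf_sum[symmetric]) auto
  also have "\<dots> = (\<Sum>n. (c ^ n /\<^sub>R fact n) * f y)"
  proof (intro suminf_cong)
    fix n
    have "(\<Sum>x\<in>V. f x * (fin_mat_pow V M n x y / fact n)) = (\<Sum>x\<in>V. f x * fin_mat_pow V M n x y) / fact n"
      by (simp add: sum_divide_distrib)
    also have "\<dots> = c ^ n / fact n * f y"
      using fin_mat_pow_left_eigenvector[where f = f, OF assms] by simp
    finally show "(\<Sum>x\<in>V. f x * (fin_mat_pow V M n x y / fact n)) = (c ^ n /\<^sub>R fact n) * f y"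
      by (simp add: scaleR_conv_of_real divide_inverse mult.commute)
  qed
  also have "\<dots> = exp c * f y"
    unfolding exp_def by (rule suminf_mult2[symmetric]) (rule summable_exp_generic)
  finally show ?thesis .
qed

text \<open>A matrix applied to \<open>basis_vec a\<close> gives its column \<open>a\<close>, so
  transfer means that this column has its only nonzero entry, of modulus 1, in row
  \<open>b\<close>.\<close>

lemma pst_at_iff:
  assumes "finite V" "a \<in> V"
  shows "pst_at V K a b \<tau> \<longleftrightarrow> \<tau> > 0 \<and> (\<exists>\<gamma>. norm \<gamma> = 1 \<and>
    (\<forall>x\<in>V. fin_mat_exp V (\<lambda>x y. - \<i> * complex_of_real \<tau> * complex_of_real (K x y)) x a
      = (if x = b then \<gamma> else 0)))"
proof -
  have "fin_mat_vec V M (basis_vec a) x = M x a" for M :: "'a \<Rightarrow> 'a \<Rightarrow> complex" and x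
    using assms by (simp add: fin_mat_vec_def basis_vec_def if_distrib cong: if_cong)
  moreover have "\<gamma> * basis_vec b x = (if x = b then \<gamma> else 0)" for \<gamma> :: complex and x
    by (simp add: basis_vec_def)
  ultimately show ?thesis unfolding pst_at_def by simp
qed

lemma exp_left_eigenvector_real:
  assumes "finite V" and "\<And>y. y \<in> V \<Longrightarrow> (\<Sum>x\<in>V. f x * K x y) = c * f y" and "y \<in> V"
  shows "(\<Sum>x\<in>V. complex_of_real (f x) *
      fin_mat_exp V (\<lambda>x y. - \<i> * complex_of_real \<tau> * complex_of_real (K x y)) x y)
    = cis (- \<tau> * c) * complex_of_real (f y)"
proof -
  have "(\<Sum>x\<in>V. complex_of_real (f x) * (- \<i> * complex_of_real \<tau> * complex_of_real (K x y)))
      = (\<i> * complex_of_real (- \<tau> * c)) * complex_of_real (f y)" if "y \<in> V" for y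
  proof -
    have "(\<Sum>x\<in>V. complex_of_real (f x) * (- \<i> * complex_of_real \<tau> * complex_of_real (K x y)))
      = - \<i> * complex_of_real \<tau> * complex_of_real (\<Sum>x\<in>V. f x * K x y)"
      unfolding of_real_sum sum_distrib_left of_real_mult by (intro sum.cong) (auto simp: algebra_simps)
    then show ?thesis using assms(2)[OF that] by simp
  qed
  from fin_mat_exp_left_eigenvector[OF assms(1) this assms(3)] show ?thesis
    by (simp add: cis_conv_exp)
qed

section \<open>Johnson graphs\<close>

lemma finite_johnson_verts: "finite S \<Longrightarrow> finite (johnson_verts S m)"
  by (simp add: johnson_verts_def)

text \<open>Each neighbour of \<open>y\<close> arises from exactly one exchange of some
  \<open>p\<close> in \<open>y\<close> for some \<open>q\<close> in \<open>S - y\<close>.\<close>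

lemma johnson_neighbour_sum:
  fixes F :: "'a set \<Rightarrow> real"
  assumes "finite S" and y: "y \<in> johnson_verts S m" 
  shows "(\<Sum>x\<in>johnson_verts S m. F x * johnson_matrix m x y)
    = (\<Sum>(p, q)\<in>y \<times> (S - y). F (insert q (y - {p})))"
proof -
  let ?V = "johnson_verts S m" and ?h = "\<lambda>(p, q). insert q (y - {p})"
  have fy: "finite y" and yS: "y \<subseteq> S" and cy: "card y = m"
    using y assms(1) by (auto simp: johnson_verts_def intro: finite_subset)
  have inj: "inj_on ?h (y \<times> (S - y))"
  proof (rule inj_onI, clarify)
    fix p q p' q'
    assume *: "insert q (y - {p}) = insert q' (y - {p'})" "p \<in> y" "p' \<in> y" "q \<in> S" "q \<notin> y" "q' \<in> S" "q' \<notin> y"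
    then have "q = q'" "\<And>z. z \<in> y \<Longrightarrow> z = p \<longleftrightarrow> z = p'" by (auto simp: set_eq_iff)
    then show "p = p' \<and> q = q'" using * by blast
  qed
  have img: "?h ` (y \<times> (S - y)) = {x \<in> ?V. johnson_adj m x y}"
  proof (intro set_eqI iffI)
    fix x assume "x \<in> ?h ` (y \<times> (S - y))"
    then obtain p q where pq: "p \<in> y" "q \<in> S" "q \<notin> y" "x = insert q (y - {p})" by auto
    have "x \<inter> y = y - {p}" using pq by auto
    moreover have "Suc (card (y - {p})) = m"
      using pq fy cy by (metis card.remove)
    moreover have "card x = Suc (card (y - {p}))" using pq fy by simp
    ultimately show "x \<in> {x \<in> ?V. johnson_adj m x y}"
      using pq yS by (auto simp: johnson_verts_def johnson_adj_def)
  next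
    fix x assume "x \<in> {x \<in> ?V. johnson_adj m x y}"
    then have x: "x \<subseteq> S" "card x = m" "card (x \<inter> y) + 1 = m"
      by (auto simp: johnson_verts_def johnson_adj_def)
    have fx: "finite x" using x assms(1) finite_subset by blast
    have "card (x - y) = 1" "card (y - x) = 1"
      using x cy fx fy card_Diff_subset_Int[of x y] card_Diff_subset_Int[of y x]
      by (auto simp: Int_commute)
    then obtain p q where "x - y = {q}" "y - x = {p}" by (meson card_1_singletonE)
    then have "x = insert q (y - {p})" "p \<in> y" "q \<in> S - y" using x by blast+
    then show "x \<in> ?h ` (y \<times> (S - y))" by auto
  qed
  have "(\<Sum>x\<in>?V. F x * johnson_matrix m x y) = (\<Sum>x\<in>{x \<in> ?V. johnson_adj m x y}. F x)"
    using finite_johnson_verts[OF assms(1)]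
    by (simp add: johnson_matrix_def sum.inter_filter if_distrib cong: if_cong)
  also have "\<dots> = (\<Sum>z\<in>y \<times> (S - y). F (?h z))"
    unfolding img[symmetric] by (simp only: sum.reindex[OF inj] o_def)
  finally show ?thesis by (simp add: case_prod_unfold)
qed

section \<open>Zonal eigenfunctions of \<open>J(2m,m)\<close>\<close>

definition zonal :: "nat \<Rightarrow> (real \<Rightarrow> real) \<Rightarrow> 'a set \<Rightarrow> 'a set \<Rightarrow> real" where
  "zonal m g a x = g (2 * real (card (x \<inter> a)) - real m)"

text \<open>The identity required of \<open>g\<close> is the action of the adjacency matrix of \<open>J(2m,m)\<close> on functions
  of the distance from \<open>a\<close>, in the centred coordinate \<open>t = 2|x \<inter> a| - m\<close>, which changes sign
  under complementation.\<close>

definition zonal_eigenfunction :: "nat \<Rightarrow> (real \<Rightarrow> real) \<Rightarrow> real \<Rightarrow> bool" where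
  "zonal_eigenfunction m g c \<longleftrightarrow> (\<forall>t. (real m + t)\<^sup>2 / 4 * g (t - 2) + (real m - t)\<^sup>2 / 4 * g (t + 2)
      + ((real m)\<^sup>2 - t\<^sup>2) / 2 * g t = c * g t)"

text \<open>An exchange changes the size \<open>k\<close> of \<open>y \<inter> a\<close> by -1, 0 or
  1. Counting the exchanges of each type gives the weights \<open>k^2\<close>,
  \<open>2k(m-k)\<close> and \<open>(m-k)^2\<close>, which in the coordinate \<open>t\<close> are
  the coefficients in \<open>zonal_eigenfunction\<close>.\<close>

lemma johnson_zonal_eigenvector:
  assumes "finite S" "card S = 2 * m" "a \<in> johnson_verts S m" "y \<in> johnson_verts S m"
    and g: "zonal_eigenfunction m g c"
  shows "(\<Sum>x\<in>johnson_verts S m. zonal m g a x * johnson_matrix m x y) = c * zonal m g a y"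
proof -
  define k where "k = card (y \<inter> a)"
  have sub: "a \<subseteq> S" "y \<subseteq> S" and card: "card a = m" "card y = m"
    using assms by (auto simp: johnson_verts_def)
  have fin: "finite a" "finite y" using sub assms(1) finite_subset by blast+
  have km: "k \<le> m" unfolding k_def using card fin by (metis card_mono inf_le1)
  \<comment> \<open>Membership in \<open>a\<close> splits the removed and the inserted elements. The
    sizes are \<open>k\<close>, \<open>m - k\<close>, \<open>m - k\<close> and \<open>k\<close>; the
    last one relies on \<open>card S = 2 * m\<close>.\<close>
  define P1 P0 Q1 Q0 where "P1 = y \<inter> a" and "P0 = y - a" and "Q1 = (S - y) \<inter> a" and "Q0 = S - y - a"
  have finPQ: "finite P1" "finite P0" "finite Q1" "finite Q0"
    using fin assms(1) by (auto simp: P1_def P0_def Q1_def Q0_def)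
  have cP: "card P1 = k" "card P0 = m - k"
    using card fin card_Diff_subset_Int[of y a] by (auto simp: P1_def P0_def k_def)
  have Q1: "Q1 = a - y" using sub by (auto simp: Q1_def)
  have cQ1: "card Q1 = m - k"
    using card fin card_Diff_subset_Int[of a y] by (simp add: Q1 k_def Int_commute)
  have "S - y = Q1 \<union> Q0" "Q1 \<inter> Q0 = {}" by (auto simp: Q1_def Q0_def)
  then have "card (S - y) = card Q1 + card Q0" using finPQ by (simp add: card_Un_disjoint)
  moreover have "card (S - y) = m" using sub fin card assms(2) by (simp add: card_Diff_subset)
  ultimately have cQ0: "card Q0 = k" using cQ1 km by simp
  define t where "t = 2 * real k - real m"
  let ?F = "\<lambda>(p, q). zonal m g a (insert q (y - {p}))"
  have z: "zonal m g a (insert q (y - {p})) =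
      g (t - (if p \<in> a then 2 else 0) + (if q \<in> a then 2 else 0))"
    if pq: "p \<in> y" "q \<in> S - y" for p q
  proof -
    have "real (card (insert q (y - {p}) \<inter> a)) = real k - (if p \<in> a then 1 else 0) + (if q \<in> a then 1 else 0)"
    proof -
      have eq: "insert q (y - {p}) \<inter> a = (if q \<in> a then insert q (y \<inter> a - {p}) else y \<inter> a - {p})"
        by auto
      have "real (card (y \<inter> a - {p})) = real k - (if p \<in> a then 1 else 0)"
      proof (cases "p \<in> a")
        case True
        then have "k = Suc (card (y \<inter> a - {p}))"
          unfolding k_def using pq fin by (metis IntI card.remove finite_Int)
        then show ?thesis using True by simp
      qed (simp add: k_def)
      then show ?thesis using pq fin by (simp add: eq)
    qed
    then have "2 * real (card (insert q (y - {p}) \<inter> a)) - real m =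
        t - (if p \<in> a then 2 else 0) + (if q \<in> a then 2 else 0)"
      by (simp only: t_def) simp
    then show ?thesis by (simp only: zonal_def)
  qed
  have split: "y = P1 \<union> P0" "S - y = Q1 \<union> Q0" by (auto simp: P1_def P0_def Q1_def Q0_def)
  have "(\<Sum>x\<in>johnson_verts S m. zonal m g a x * johnson_matrix m x y) = sum ?F (y \<times> (S - y))"
    by (rule johnson_neighbour_sum[OF assms(1,4)])
  also have "\<dots> = (\<Sum>p\<in>y. \<Sum>q\<in>S - y. g (t - (if p \<in> a then 2 else 0) + (if q \<in> a then 2 else 0)))"
    unfolding sum.cartesian_product[symmetric] by (intro sum.cong refl) (rule z)
  also have "\<dots> = (\<Sum>p\<in>P1 \<union> P0. \<Sum>q\<in>Q1 \<union> Q0. g (t - (if p \<in> a then 2 else 0) + (if q \<in> a then 2 else 0)))"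
    using split by simp
  also have "\<dots> = (\<Sum>p\<in>P1. \<Sum>q\<in>Q1. g t) + (\<Sum>p\<in>P1. \<Sum>q\<in>Q0. g (t - 2))
      + (\<Sum>p\<in>P0. \<Sum>q\<in>Q1. g (t + 2)) + (\<Sum>p\<in>P0. \<Sum>q\<in>Q0. g t)"
  proof -
    \<comment> \<open>The inner sum over \<open>q\<close> once the removal of \<open>p\<close> has
      lowered the coordinate by \<open>c\<close>, which is 2 or 0.\<close>
    define f where "f c = (\<Sum>q\<in>Q1. g (t - c + 2)) + (\<Sum>q\<in>Q0. g (t - c))" for c
    have "(\<Sum>q\<in>Q1 \<union> Q0. g (t - c + (if q \<in> a then 2 else 0))) = f c" for c
    proof -
      have "(\<Sum>q\<in>Q1 \<union> Q0. g (t - c + (if q \<in> a then 2 else 0)))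
          = (\<Sum>q\<in>Q1. g (t - c + (if q \<in> a then 2 else 0))) + (\<Sum>q\<in>Q0. g (t - c + (if q \<in> a then 2 else 0)))"
        using finPQ by (intro sum.union_disjoint) (auto simp: Q1_def Q0_def)
      also have "\<dots> = f c"
        unfolding f_def by (intro arg_cong2[where f = "(+)"] sum.cong refl) (auto simp: Q1_def Q0_def)
      finally show ?thesis .
    qed
    then have "(\<Sum>p\<in>P1 \<union> P0. \<Sum>q\<in>Q1 \<union> Q0. g (t - (if p \<in> a then 2 else 0) + (if q \<in> a then 2 else 0)))
        = (\<Sum>p\<in>P1 \<union> P0. f (if p \<in> a then 2 else 0))" by (simp only:)
    also have "\<dots> = (\<Sum>p\<in>P1. f (if p \<in> a then 2 else 0)) + (\<Sum>p\<in>P0. f (if p \<in> a then 2 else 0))"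
      using finPQ by (intro sum.union_disjoint) (auto simp: P1_def P0_def)
    also have "\<dots> = (\<Sum>p\<in>P1. f 2) + (\<Sum>p\<in>P0. f 0)"
      by (intro arg_cong2[where f = "(+)"] sum.cong refl) (auto simp: P1_def P0_def)
    finally show ?thesis by (simp add: f_def algebra_simps)
  qed
  also have "\<dots> = (real k)\<^sup>2 * g (t - 2) + (real (m - k))\<^sup>2 * g (t + 2) + 2 * real k * real (m - k) * g t"
    by (simp add: cP cQ1 cQ0 power2_eq_square)
  also have "\<dots> = (real m + t)\<^sup>2 / 4 * g (t - 2) + (real m - t)\<^sup>2 / 4 * g (t + 2)
      + ((real m)\<^sup>2 - t\<^sup>2) / 2 * g t"
  proof -
    have "real m + t = 2 * real k" "real m - t = 2 * real (m - k)"
      using km by (simp_all add: t_def of_nat_diff)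
    moreover from this have "(real m)\<^sup>2 - t\<^sup>2 = 4 * (real k * real (m - k))"
      by (simp add: square_diff_square_factored power2_eq_square)
    ultimately show ?thesis by (simp add: power_mult_distrib del: of_nat_diff)
  qed
  also have "\<dots> = c * zonal m g a y"
    using g unfolding zonal_eigenfunction_def zonal_def t_def k_def by blast
  finally show ?thesis .
qed

text \<open>The centre \<open>a\<close> and the column \<open>y\<close> are independent: necessity
  takes them equal, while sufficiency lets the centre run through all vertices and keeps the column
  fixed.\<close>

lemma johnson_exp_zonal:
  assumes "finite S" "card S = 2 * m" "a \<in> johnson_verts S m" "y \<in> johnson_verts S m"
    and "zonal_eigenfunction m g c"
  shows "(\<Sum>x\<in>johnson_verts S m. complex_of_real (zonal m g a x) *
      fin_mat_exp (johnson_verts S m) (\<lambda>x y. - \<i> * complex_of_real \<tau> *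
        complex_of_real (fin_mat_pow (johnson_verts S m) (johnson_matrix m) r x y)) x y)
    = cis (- \<tau> * c ^ r) * complex_of_real (zonal m g a y)"
  using assms
  by (intro exp_left_eigenvector_real fin_mat_pow_left_eigenvector johnson_zonal_eigenvector
      finite_johnson_verts)

section \<open>Transfer only reaches the complement\<close>

lemma johnson_pst_complement:
  assumes "finite S" "1 \<le> m" "a \<in> johnson_verts S m" "b \<in> johnson_verts S m" "a \<noteq> b"
    and pst: "pst_at (johnson_verts S m)
      (fin_mat_pow (johnson_verts S m) (johnson_matrix m) r) a b \<tau>"
  shows "b = S - a"
proof -
  let ?V = "johnson_verts S m"
  let ?K = "fin_mat_pow ?V (johnson_matrix m) r"
  let ?M = "\<lambda>x y. - \<i> * complex_of_real \<tau> * complex_of_real (?K x y)"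
  have finV: "finite ?V" using assms finite_johnson_verts by blast
  obtain \<gamma> where \<gamma>: "norm \<gamma> = 1"
    "\<And>x. x \<in> ?V \<Longrightarrow> fin_mat_exp ?V ?M x a = (if x = b then \<gamma> else 0)"
    using pst unfolding pst_at_iff[OF finV assms(3)] by blast
  have sub: "a \<subseteq> S" "b \<subseteq> S" and card: "card a = m" "card b = m"
    using assms by (auto simp: johnson_verts_def)
  have fin: "finite a" "finite b" using sub assms(1) finite_subset by blast+
  \<comment> \<open>Such a transposition fixes \<open>a\<close> and preserves the exponential, so it
    maps the only nonzero row of column \<open>a\<close> to a nonzero row, which must again be
    \<open>b\<close>.\<close>
  have fixed: "transpose p q ` b = b"
    if pq: "p \<in> S" "q \<in> S" "p \<in> a \<longleftrightarrow> q \<in> a" for p q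
  proof -
    let ?s = "\<lambda>X. transpose p q ` X"
    have inv: "?s (?s X) = X" for X :: "'a set" by (simp add: image_image)
    have mem: "?s X \<in> ?V" if "X \<in> ?V" for X
    proof -
      have "?s X \<subseteq> S" using that pq by (auto simp: johnson_verts_def transpose_def)
      then show ?thesis using that by (simp add: johnson_verts_def card_image)
    qed
    have bij: "bij_betw ?s ?V ?V"
      by (rule bij_betw_byWitness[where f' = ?s]) (use inv mem in blast)+
    have A: "johnson_matrix m (?s X) (?s Y) = johnson_matrix m X Y" for X Y
    proof -
      have "?s X \<inter> ?s Y = ?s (X \<inter> Y)" by (rule image_Int[symmetric]) simp
      then show ?thesis by (simp add: johnson_matrix_def johnson_adj_def card_image)
    qed
    have K: "?K (?s X) (?s Y) = ?K X Y" if "X \<in> ?V" "Y \<in> ?V" for X Y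
      by (rule fin_mat_pow_invariant[where s = ?s, OF bij _ that]) (rule A)
    have "fin_mat_exp ?V ?M (?s b) (?s a) = fin_mat_exp ?V ?M b a"
      unfolding fin_mat_exp_def
      by (intro suminf_cong arg_cong2[where f = "(/)"] refl fin_mat_pow_invariant[where s = ?s, OF bij _ assms(4,3)])
        (simp only: K)
    moreover have "?s a = a"
      using pq by (auto simp: transpose_def image_iff split: if_splits)
    ultimately have "fin_mat_exp ?V ?M (?s b) a = \<gamma>" using \<gamma> assms by simp
    then show ?thesis using \<gamma>(2)[OF mem[OF assms(4)]] \<gamma>(1) by (auto split: if_splits)
  qed
  have swap: "p \<notin> b \<or> q \<in> b" if "p \<in> S" "q \<in> S" "p \<in> a \<longleftrightarrow> q \<in> a" for p q
    using fixed[OF that] by (metis imageI transpose_apply_first)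
  \<comment> \<open>By \<open>swap\<close>, each of \<open>a\<close> and \<open>S - a\<close> lies
    inside \<open>b\<close> or misses it. Equal cardinalities and \<open>a \<noteq> b\<close>
    exclude the first for \<open>a\<close>; then \<open>b\<close>, being nonempty, meets
    \<open>S - a\<close> and contains it.\<close>
  have "\<not> a \<subseteq> b" using card assms(5) card_subset_eq[OF fin(2)] by auto
  then obtain p where p: "p \<in> a" "p \<notin> b" by blast
  have disj: "x \<notin> b" if "x \<in> a" for x using swap[of x p] p that sub by auto
  obtain x where x: "x \<in> b" using card assms(2) by fastforce
  have "y \<in> b" if "y \<in> S - a" for y
    using swap[of x y] that x disj sub by auto
  then show ?thesis using disj sub by blast
qed

section \<open>The first five eigenvalues of \<open>J(2m,m)\<close>\<close>

text \<open>The Johnson eigenvalue \<open>(m - j)(v - m - j) - j\<close> at \<open>v = 2m\<close>.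
  Integers are used because the exclusions later rest on divisibility by 2.\<close>

definition johnson_eigval :: "nat \<Rightarrow> nat \<Rightarrow> int" where
  "johnson_eigval m j = (int m - int j)\<^sup>2 - int j"

text \<open>The coefficients come from solving the eigenfunction identity for a polynomial of degree \<open>j\<close>
  from the leading term down, and clearing denominators. Values \<open>j > 4\<close> are junk.\<close>

definition zonal_poly :: "nat \<Rightarrow> nat \<Rightarrow> real \<Rightarrow> real" where
  "zonal_poly n j t = (let m = real n in
     if j = 0 then 1 else if j = 1 then t
     else if j = 2 then (2 * m - 1) * t ^ 2 - m ^ 2
     else if j = 3 then (2 * m - 3) * t ^ 3 - (3 * m ^ 2 - 4 * m) * t
     else (2 * m - 5) * (2 * m - 3) * t ^ 4 - (2 * m - 3) * (6 * m ^ 2 - 16 * m + 4) * t ^ 2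
       + 3 * m ^ 2 * (m - 2) ^ 2)"

lemma le_4_cases: "(j::nat) \<le> 4 \<Longrightarrow> j = 0 \<or> j = 1 \<or> j = 2 \<or> j = 3 \<or> j = 4"
  by auto

lemma zonal_poly_eigenfunction:
  assumes "j \<le> 4"
  shows "zonal_eigenfunction m (zonal_poly m j) (real_of_int (johnson_eigval m j))"
proof -
  \<comment> \<open>Multiplied by 4, the eigenfunction identity is a polynomial identity without
    denominators, to be checked degree by degree.\<close>
  have "(real m + t)\<^sup>2 * zonal_poly m j (t - 2) + (real m - t)\<^sup>2 * zonal_poly m j (t + 2)
      + 2 * ((real m)\<^sup>2 - t\<^sup>2) * zonal_poly m j t = 4 * johnson_eigval m j * zonal_poly m j t" for t
    using le_4_cases[OF assms]
  proof (elim disjE)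
    assume j: "j = 0" show ?thesis
      unfolding j zonal_poly_def Let_def johnson_eigval_def by simp algebra
  next
    assume j: "j = 1" show ?thesis
      unfolding j zonal_poly_def Let_def johnson_eigval_def by simp algebra
  next
    assume j: "j = 2" show ?thesis
      unfolding j zonal_poly_def Let_def johnson_eigval_def by simp algebra
  next
    assume j: "j = 3" show ?thesis
      unfolding j zonal_poly_def Let_def johnson_eigval_def by simp algebra
  next
    assume j: "j = 4" show ?thesis
      unfolding j zonal_poly_def Let_def johnson_eigval_def by simp algebra
  qed
  note eq = this
  have four: "(real m + t)\<^sup>2 / 4 * g1 + (real m - t)\<^sup>2 / 4 * g2 + ((real m)\<^sup>2 - t\<^sup>2) / 2 * g3
      = ((real m + t)\<^sup>2 * g1 + (real m - t)\<^sup>2 * g2 + 2 * ((real m)\<^sup>2 - t\<^sup>2) * g3) / 4" for t g1 g2 g3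
    by (simp add: field_simps)
  show ?thesis unfolding zonal_eigenfunction_def four eq by simp
qed

lemma zonal_poly_minus: "j \<le> 4 \<Longrightarrow> zonal_poly m j (- t) = (-1) ^ j * zonal_poly m j t"
  using le_4_cases[of j] by (auto simp: zonal_poly_def Let_def)

text \<open>The argument \<open>real m\<close> is the coordinate of \<open>x = a\<close>, so this
  allows the value at the centre to be cancelled when phases are compared. The factors of that value
  vanish only for \<open>m < j\<close>.\<close>

lemma zonal_poly_nonzero:
  assumes "j \<le> 4" "j \<le> m" "1 \<le> m"
  shows "zonal_poly m j (real m) \<noteq> 0"
proof -
  have "zonal_poly m 2 (real m) = 2 * real m ^ 2 * (real m - 1)"
    "zonal_poly m 3 (real m) = 2 * real m ^ 2 * (real m - 1) * (real m - 2)"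
    "zonal_poly m 4 (real m) = 4 * real m ^ 2 * (real m - 1) ^ 2 * (real m - 2) * (real m - 3)"
    by (simp_all add: zonal_poly_def Let_def algebra_simps power2_eq_square power3_eq_cube power4_eq_xxxx)
  then show ?thesis using le_4_cases[OF assms(1)] assms(2,3)
    by (auto simp: zonal_poly_def Let_def)
qed

section \<open>Phases\<close>

lemma cis_int_pi: "cis (of_int k * pi) = (if even k then 1 else - 1)"
proof (cases "even k")
  case True
  then obtain n where "k = 2 * n" by blast
  then have "of_int k * pi = 2 * pi * of_int n" by simp
  then show ?thesis using True by (simp only: cis_multiple_2pi[OF Ints_of_int]) simp
next
  case False
  then obtain n where "k = 2 * n + 1" by (meson oddE)
  then have "of_int k * pi = 2 * pi * of_int n + pi" by (simp add: algebra_simps)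
  then have "cis (of_int k * pi) = cis (2 * pi * of_int n) * cis pi" by (simp only: cis_mult)
  then show ?thesis using False by (simp only: cis_multiple_2pi[OF Ints_of_int]) simp
qed

lemma cis_eq_minus_one_power:
  assumes "cis x = (-1) ^ j"
  shows "\<exists>k::int. x = of_int k * pi \<and> (even k \<longleftrightarrow> even j)"
proof (cases "even j")
  case True
  then have "cos x = 1" using arg_cong[OF assms, of Re] by simp
  then obtain n :: int where "x = of_int n * 2 * pi" using cos_one_2pi_int by blast
  then show ?thesis using True by (intro exI[of _ "2 * n"]) simp
next
  case False
  then have "cos (x - pi) = 1" using arg_cong[OF assms, of Re] by simp
  then obtain n :: int where "x - pi = of_int n * 2 * pi" using cos_one_2pi_int by blast
  then show ?thesis using False by (intro exI[of _ "2 * n + 1"]) (simp add: algebra_simps)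
qed

text \<open>Subtracting from the power for \<open>j = 0\<close> removes the unknown global phase
  \<gamma>; the parity of \<open>k\<close> records the sign of complementation on the
  eigenspace.\<close>

definition phase_condition :: "nat \<Rightarrow> nat \<Rightarrow> real \<Rightarrow> nat \<Rightarrow> bool" where
  "phase_condition m r \<tau> j \<longleftrightarrow> (\<exists>k::int.
     \<tau> * of_int (johnson_eigval m 0 ^ r - johnson_eigval m j ^ r) = of_int k * pi \<and> (even k \<longleftrightarrow> even j))"

text \<open>Paired with a zonal function centred at \<open>a\<close>, column \<open>a\<close>
  contributes only its row \<open>S - a\<close>, where the function is \<open>(-1)^i\<close> times
  its value at \<open>a\<close>. So the phase for \<open>i\<close> is
  \<open>\<gamma> * (-1)^i\<close>, and dividing by the case \<open>i = 0\<close> eliminates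
  \<gamma>.\<close>

lemma johnson_pst_imp_phase_condition:
  assumes "finite S" "card S = 2 * m" "1 \<le> m" "a \<in> johnson_verts S m"
    and pst: "pst_at (johnson_verts S m)
      (fin_mat_pow (johnson_verts S m) (johnson_matrix m) r) a (S - a) \<tau>"
    and "j \<le> 4" "j \<le> m"
  shows "phase_condition m r \<tau> j"
proof -
  let ?V = "johnson_verts S m"
  let ?K = "fin_mat_pow ?V (johnson_matrix m) r"
  let ?M = "\<lambda>x y. - \<i> * complex_of_real \<tau> * complex_of_real (?K x y)"
  let ?c = "\<lambda>j. real_of_int (johnson_eigval m j)"
  have finV: "finite ?V" using assms finite_johnson_verts by blast
  have a: "a \<subseteq> S" "card a = m" "finite a"
    using assms(1,4) by (auto simp: johnson_verts_def intro: finite_subset)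
  then have b: "S - a \<in> ?V" using assms by (simp add: johnson_verts_def card_Diff_subset)
  obtain \<gamma> where \<gamma>: "norm \<gamma> = 1"
    "\<And>x. x \<in> ?V \<Longrightarrow> fin_mat_exp ?V ?M x a = (if x = S - a then \<gamma> else 0)"
    using pst unfolding pst_at_iff[OF finV assms(4)] by blast
  have phase: "cis (- \<tau> * ?c i ^ r) = \<gamma> * (-1) ^ i" if i: "i \<le> 4" "i \<le> m" for i
  proof -
    let ?g = "zonal_poly m i"
    have "cis (- \<tau> * ?c i ^ r) * complex_of_real (zonal m ?g a a)
      = (\<Sum>x\<in>?V. complex_of_real (zonal m ?g a x) * fin_mat_exp ?V ?M x a)"
      by (rule johnson_exp_zonal[OF assms(1,2,4,4) zonal_poly_eigenfunction[OF i(1)], symmetric])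
    also have "\<dots> = (\<Sum>x\<in>?V. if x = S - a then complex_of_real (zonal m ?g a x) * \<gamma> else 0)"
      by (intro sum.cong refl) (simp only: \<gamma>(2), simp)
    also have "\<dots> = complex_of_real (zonal m ?g a (S - a)) * \<gamma>"
      using finV b by simp
    also have "zonal m ?g a (S - a) = (-1) ^ i * zonal m ?g a a"
    proof -
      have "(S - a) \<inter> a = {}" by blast
      then show ?thesis using a zonal_poly_minus[OF i(1), of m "real m"] by (simp add: zonal_def)
    qed
    finally have "cis (- \<tau> * ?c i ^ r) * complex_of_real (?g (real m))
        = (\<gamma> * (-1) ^ i) * complex_of_real (?g (real m))"
      using a by (simp add: zonal_def mult.commute)
    then show ?thesis using zonal_poly_nonzero[OF i assms(3)] by simp
  qed
  have "\<gamma> \<noteq> 0" using \<gamma>(1) by auto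
  have "cis (\<tau> * of_int (johnson_eigval m 0 ^ r - johnson_eigval m j ^ r))
      = cis (- \<tau> * ?c j ^ r) / cis (- \<tau> * ?c 0 ^ r)"
    by (simp add: cis_divide algebra_simps)
  also have "\<dots> = (-1) ^ j"
    using phase[OF assms(6,7)] phase[of 0] \<open>\<gamma> \<noteq> 0\<close> by simp
  finally show ?thesis unfolding phase_condition_def by (rule cis_eq_minus_one_power)
qed

text \<open>By \<open>delta\<close>, the point mass at any vertex \<open>x\<close> is a combination
  of zonal eigenfunctions centred at \<open>x\<close>. Pairing it with column \<open>a\<close>
  therefore computes the entry in row \<open>x\<close> from the phases alone.\<close>

lemma johnson_pst_at_complement:
  assumes "finite S" "card S = 2 * m" "a \<in> johnson_verts S m" "m \<le> 4" "0 < \<tau>"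
    and phase: "\<And>j. j \<le> m \<Longrightarrow> phase_condition m r \<tau> j"
    and delta: "\<And>k. k \<le> m \<Longrightarrow>
      (\<Sum>j\<le>m. \<alpha> j * zonal_poly m j (2 * real k - real m)) = (if k = m then 1 else 0)"
  shows "pst_at (johnson_verts S m)
      (fin_mat_pow (johnson_verts S m) (johnson_matrix m) r) a (S - a) \<tau>"
proof -
  let ?V = "johnson_verts S m"
  let ?K = "fin_mat_pow ?V (johnson_matrix m) r"
  let ?M = "\<lambda>x y. - \<i> * complex_of_real \<tau> * complex_of_real (?K x y)"
  let ?c = "\<lambda>j. real_of_int (johnson_eigval m j)"
  define \<gamma> where "\<gamma> = cis (- \<tau> * ?c 0 ^ r)"
  have finV: "finite ?V" using assms finite_johnson_verts by blast
  have a: "a \<subseteq> S" "card a = m" "finite a"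
    using assms(1,3) by (auto simp: johnson_verts_def intro: finite_subset)
  have ph: "cis (- \<tau> * ?c j ^ r) = \<gamma> * (-1) ^ j" if jm: "j \<le> m" for j
  proof -
    obtain k :: int where k: "\<tau> * of_int (johnson_eigval m 0 ^ r - johnson_eigval m j ^ r) = of_int k * pi"
      "even k \<longleftrightarrow> even j"
      using phase[OF jm] unfolding phase_condition_def by blast
    have "- \<tau> * ?c j ^ r = - \<tau> * ?c 0 ^ r + \<tau> * of_int (johnson_eigval m 0 ^ r - johnson_eigval m j ^ r)"
      by (simp add: algebra_simps)
    then have "cis (- \<tau> * ?c j ^ r) = \<gamma> * cis (of_int k * pi)"
      unfolding \<gamma>_def k(1) cis_mult by simp
    then show ?thesis using k(2) by (simp add: cis_int_pi)
  qed
  have "fin_mat_exp ?V ?M x a = (if x = S - a then \<gamma> else 0)" if x: "x \<in> ?V" for x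
  proof -
    have xS: "x \<subseteq> S" "card x = m" "finite x"
      using assms(1) x by (auto simp: johnson_verts_def intro: finite_subset)
    let ?k = "card (a \<inter> x)"
    have km: "?k \<le> m" using a by (metis card_mono inf_le1)
    have exp: "(\<Sum>j\<le>m. \<alpha> j * zonal m (zonal_poly m j) x y) = (if y = x then 1 else 0)" if "y \<in> ?V" for y
    proof -
      have y: "card y = m" "finite y"
        using assms(1) that by (auto simp: johnson_verts_def intro: finite_subset)
      have "card (y \<inter> x) = m \<longleftrightarrow> y = x"
        using y xS by (metis card_subset_eq inf.idem inf_le1 inf_le2)
      moreover have "card (y \<inter> x) \<le> m" using y by (metis card_mono inf_le1)
      ultimately show ?thesis using delta by (simp add: zonal_def)
    qed
    have "fin_mat_exp ?V ?M x a = (\<Sum>y\<in>?V. if y = x then fin_mat_exp ?V ?M y a else 0)"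
      using finV x by simp
    also have "\<dots> = (\<Sum>y\<in>?V. complex_of_real (\<Sum>j\<le>m. \<alpha> j * zonal m (zonal_poly m j) x y)
        * fin_mat_exp ?V ?M y a)"
      by (intro sum.cong) (auto simp: exp simp del: of_real_sum)
    also have "\<dots> = (\<Sum>j\<le>m. complex_of_real (\<alpha> j) *
        (\<Sum>y\<in>?V. complex_of_real (zonal m (zonal_poly m j) x y) * fin_mat_exp ?V ?M y a))"
      unfolding of_real_sum of_real_mult sum_distrib_left sum_distrib_right mult.assoc
      by (rule sum.swap)
    also have "\<dots> = (\<Sum>j\<le>m. complex_of_real (\<alpha> j) * (\<gamma> * (-1) ^ j * complex_of_real (zonal m (zonal_poly m j) x a)))"
    proof (intro sum.cong refl arg_cong2[where f = "(*)"])
      fix j assume "j \<in> {..m}"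
      then have "j \<le> m" "j \<le> 4" using assms(4) by simp_all
      then show "(\<Sum>y\<in>?V. complex_of_real (zonal m (zonal_poly m j) x y) * fin_mat_exp ?V ?M y a)
          = \<gamma> * (-1) ^ j * complex_of_real (zonal m (zonal_poly m j) x a)"
        unfolding ph[OF \<open>j \<le> m\<close>, symmetric]
        by (intro johnson_exp_zonal[OF assms(1,2) x assms(3)] zonal_poly_eigenfunction)
    qed
    also have "\<dots> = \<gamma> * complex_of_real (\<Sum>j\<le>m. \<alpha> j * ((-1) ^ j * zonal m (zonal_poly m j) x a))"
      by (simp add: sum_distrib_left algebra_simps)
    \<comment> \<open>The signs reflect the coordinate, replacing \<open>card (a \<inter> x)\<close>
      by \<open>m - card (a \<inter> x)\<close>; so \<open>delta\<close> now detects disjointness of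
      \<open>a\<close> and \<open>x\<close>.\<close>
    also have "(\<Sum>j\<le>m. \<alpha> j * ((-1) ^ j * zonal m (zonal_poly m j) x a))
        = (\<Sum>j\<le>m. \<alpha> j * zonal_poly m j (2 * real (m - ?k) - real m))"
    proof (intro sum.cong refl)
      fix j assume "j \<in> {..m}"
      then have "j \<le> 4" using assms(4) by simp
      have "2 * real (m - ?k) - real m = - (2 * real ?k - real m)"
        using km by (simp add: of_nat_diff)
      then show "\<alpha> j * ((-1) ^ j * zonal m (zonal_poly m j) x a)
          = \<alpha> j * zonal_poly m j (2 * real (m - ?k) - real m)"
        using zonal_poly_minus[OF \<open>j \<le> 4\<close>, of m "2 * real ?k - real m"] by (simp only: zonal_def)
    qed
    also have "\<dots> = (if m - ?k = m then 1 else 0)"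
      by (rule delta) simp
    also have "m - ?k = m \<longleftrightarrow> x = S - a"
    proof
      assume "m - ?k = m"
      then have "a \<inter> x = {}" using km a by (cases "?k = 0") auto
      then have "x \<subseteq> S - a" using xS by blast
      moreover have "card (S - a) = m" using a assms(2) by (simp add: card_Diff_subset)
      ultimately show "x = S - a" using xS assms(1) by (metis card_subset_eq finite_Diff)
    next
      assume "x = S - a"
      then have "a \<inter> x = {}" by blast
      then show "m - ?k = m" by simp
    qed
    finally show ?thesis by simp
  qed
  moreover have "norm \<gamma> = 1" by (simp add: \<gamma>_def)
  ultimately show ?thesis unfolding pst_at_iff[OF finV assms(3)] using assms(5) by blast
qed

section \<open>Parity of the phases\<close>

text \<open>The cofactor of \<open>x - y\<close> is a sum of \<open>r\<close> odd terms with
  \<open>r\<close> odd.\<close>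

lemma odd_power_diff_factor:
  fixes x y :: int
  assumes "odd x" "odd y" "odd r"
  shows "\<exists>u. odd u \<and> x ^ r - y ^ r = (x - y) * u"
proof (intro exI conjI)
  show "x ^ r - y ^ r = (x - y) * (\<Sum>i<r. y ^ (r - Suc i) * x ^ i)"
    by (rule power_diff_sumr2)
  show "odd (\<Sum>i<r. y ^ (r - Suc i) * x ^ i)"
    using assms by (simp add: even_sum_iff)
qed

text \<open>Lifting the exponent at 2: the power of 2 gained does not depend on the bases.\<close>

lemma power_diff_factor_uniform:
  assumes "1 \<le> s"
  shows "\<exists>e. \<forall>x y :: int. x mod 4 = 1 \<and> y mod 4 = 1 \<longrightarrow>
    (\<exists>u. odd u \<and> x ^ s - y ^ s = (x - y) * 2 ^ e * u)"
  using assms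
proof (induction s rule: less_induct)
  case (less s)
  have odd4: "odd x" if "x mod 4 = 1" for x :: int using that by presburger
  show ?case
  proof (cases "odd s")
    case True
    then show ?thesis
      using odd_power_diff_factor[OF _ _ True] odd4 by (intro exI[of _ 0]) auto
  next
    case False
    then obtain n where n: "s = 2 * n" by blast
    then obtain e where e: "\<And>x y :: int. x mod 4 = 1 \<Longrightarrow> y mod 4 = 1 \<Longrightarrow>
        \<exists>u. odd u \<and> x ^ n - y ^ n = (x - y) * 2 ^ e * u"
      using less.IH[of n] less.prems by auto
    show ?thesis
    proof (intro exI[of _ "Suc e"] allI impI, elim conjE)
      fix x y :: int
      assume xy: "x mod 4 = 1" "y mod 4 = 1"
      then obtain u where u: "odd u" "x ^ n - y ^ n = (x - y) * 2 ^ e * u" using e by blast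
      have "x ^ n mod 4 = 1" "y ^ n mod 4 = 1"
        using xy power_mod[of x 4 n] power_mod[of y 4 n] by simp_all
      \<comment> \<open>A sum of two numbers congruent to 1 mod 4 is 2 mod 4, so each halving of the
        exponent gains exactly one factor 2.\<close>
      moreover have "\<exists>w. p + q = 2 * w \<and> odd w" if "p mod 4 = 1" "q mod 4 = 1" for p q :: int
        using that by presburger
      ultimately obtain w where w: "x ^ n + y ^ n = 2 * w" "odd w" by blast
      have "x ^ s - y ^ s = (x ^ n - y ^ n) * (x ^ n + y ^ n)"
        by (simp add: n power_mult power2_eq_square algebra_simps mult_2 power_add)
      then have "x ^ s - y ^ s = (x - y) * 2 ^ Suc e * (u * w)" by (simp add: u w)
      then show "\<exists>u. odd u \<and> x ^ s - y ^ s = (x - y) * 2 ^ Suc e * u"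
        using u(1) w(2) by (intro exI[of _ "u * w"]) simp
    qed
  qed
qed

text \<open>Cross-multiplying the two conditions eliminates \<tau> and leaves an equation between
  integers, whose powers of 2 can be compared.\<close>

lemma phase_condition_eliminate:
  assumes "phase_condition m r \<tau> i" "phase_condition m r \<tau> j"
  shows "\<exists>k l. k * (johnson_eigval m 0 ^ r - johnson_eigval m j ^ r)
        = l * (johnson_eigval m 0 ^ r - johnson_eigval m i ^ r)
      \<and> (even k \<longleftrightarrow> even i) \<and> (even l \<longleftrightarrow> even j)"
proof -
  let ?D = "\<lambda>i. johnson_eigval m 0 ^ r - johnson_eigval m i ^ r"
  obtain k l :: int where k: "\<tau> * of_int (?D i) = of_int k * pi" "even k \<longleftrightarrow> even i"
    and l: "\<tau> * of_int (?D j) = of_int l * pi" "even l \<longleftrightarrow> even j"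
    using assms unfolding phase_condition_def by blast
  have "pi * of_int (k * ?D j) = \<tau> * of_int (?D i) * of_int (?D j)"
    unfolding k(1) by simp
  also have "\<dots> = \<tau> * of_int (?D j) * of_int (?D i)" by (simp only: mult_ac)
  also have "\<dots> = pi * of_int (l * ?D i)" unfolding l(1) by simp
  finally have "pi * of_int (k * ?D j) = pi * of_int (l * ?D i)" .
  then have "k * ?D j = l * ?D i" by (simp only: mult_cancel_left of_int_eq_iff pi_neq_zero simp_thms)
  then show ?thesis using k l by blast
qed

text \<open>In each case a common power of 2 cancels from \<open>k * ?D j = l * ?D 1\<close> so that
  the cofactor of the odd \<open>k\<close> becomes odd, while \<open>l\<close> is even.\<close>

lemma phase_conditions_contradictory:
  assumes "2 \<le> m" "1 \<le> r" "m = 3 \<Longrightarrow> odd r"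
    and phase: "\<And>j. j \<le> 4 \<Longrightarrow> j \<le> m \<Longrightarrow> phase_condition m r \<tau> j"
  shows False
proof -
  let ?D = "\<lambda>i. johnson_eigval m 0 ^ r - johnson_eigval m i ^ r"
  let ?m = "int m"
  have ev: "johnson_eigval m 0 = ?m\<^sup>2" "johnson_eigval m 1 = ?m * (?m - 2)"
    "johnson_eigval m 2 = ?m\<^sup>2 - 4 * ?m + 2" "johnson_eigval m 4 = ?m\<^sup>2 - 8 * ?m + 12"
    by (simp_all add: johnson_eigval_def power2_eq_square algebra_simps)
  obtain k l where kl: "k * ?D 2 = l * ?D 1" "odd k" "even l"
    using phase_condition_eliminate[OF phase[of 1] phase[of 2]] assms(1) by auto
  consider "even m" | "odd m" "odd r" | "odd m" "even r" "5 \<le> m"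
  proof -
    have "m = 3 \<or> 5 \<le> m" if "odd m"
      using assms(1) that by presburger
    then show ?thesis using assms(3) that by blast
  qed
  then show False
  proof cases
    case 1
    then obtain n where n: "?m = 2 * n" by (metis even_of_nat evenE)
    \<comment> \<open>All three eigenvalues are even. After halving, those for 0 and 1 are still
      even and the one for 2 is odd.\<close>
    have D2: "?D 2 = 2 ^ r * ((2 * n\<^sup>2) ^ r - (2 * n\<^sup>2 - 4 * n + 1) ^ r)"
      unfolding ev n right_diff_distrib power_mult_distrib[symmetric]
      by (simp add: algebra_simps power2_eq_square)
    have D1: "?D 1 = 2 ^ r * ((2 * n\<^sup>2) ^ r - (2 * (n * (n - 1))) ^ r)"
      unfolding ev n right_diff_distrib power_mult_distrib[symmetric]
      by (simp add: algebra_simps power2_eq_square)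
    have "k * ((2 * n\<^sup>2) ^ r - (2 * n\<^sup>2 - 4 * n + 1) ^ r)
        = l * ((2 * n\<^sup>2) ^ r - (2 * (n * (n - 1))) ^ r)"
      using kl(1) unfolding D1 D2 mult.left_commute[of _ "2 ^ r"] by simp
    moreover have "odd ((2 * n\<^sup>2) ^ r - (2 * n\<^sup>2 - 4 * n + 1) ^ r)" using assms(2) by simp
    ultimately show False using kl by (metis even_mult_iff)
  next
    case 2
    \<comment> \<open>The eigenvalues are odd and differ from the one for 0 by \<open>2m\<close> and
      \<open>2(2m - 1)\<close>; an odd exponent changes \<open>?D 2\<close> only by an odd
      factor.\<close>
    have "odd (?m\<^sup>2)" "odd (?m * (?m - 2))" "odd (?m\<^sup>2 - 4 * ?m + 2)" using 2 by simp_all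
    then obtain u1 u2 where u: "odd u2" "?D 1 = (?m\<^sup>2 - ?m * (?m - 2)) * u1"
      "?D 2 = (?m\<^sup>2 - (?m\<^sup>2 - 4 * ?m + 2)) * u2"
      unfolding ev using odd_power_diff_factor 2 by metis
    have "?D 1 = 2 * (?m * u1)" "?D 2 = 2 * ((2 * ?m - 1) * u2)"
      unfolding u(2,3) by (simp_all add: algebra_simps power2_eq_square)
    then have "k * ((2 * ?m - 1) * u2) = l * (?m * u1)" using kl(1) by simp
    moreover have "odd (k * ((2 * ?m - 1) * u2))" "even (l * (?m * u1))" using kl u by auto
    ultimately show False by simp
  next
    case 3
    obtain k l where kl: "k * ?D 4 = l * ?D 1" "odd k" "even l"
      using phase_condition_eliminate[OF phase[of 1] phase[of 4]] 3 by auto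
    obtain s where s: "r = 2 * s" "1 \<le> s" using 3 assms(2) by (auto elim!: evenE)
    \<comment> \<open>With \<open>r = 2 * s\<close> the bases are odd squares, hence 1 mod 4. As
      \<open>e\<close> is chosen before the bases, the same \<open>2 ^ e\<close> occurs in both
      differences; besides it, \<open>?D 4\<close> has exactly the factor 8 and \<open>?D 1\<close>
      at least that.\<close>
    obtain e where e: "\<And>x y :: int. x mod 4 = 1 \<Longrightarrow> y mod 4 = 1 \<Longrightarrow>
        \<exists>u. odd u \<and> x ^ s - y ^ s = (x - y) * 2 ^ e * u"
      using power_diff_factor_uniform[OF s(2)] by blast
    obtain n where n: "?m = 2 * n + 1" using 3 by (metis even_of_nat oddE)
    have sq: "x\<^sup>2 mod 4 = 1" if "odd x" for x :: int
    proof -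
      from that obtain z where "x = 2 * z + 1" by (meson oddE)
      then have "x\<^sup>2 = 1 + 4 * (z\<^sup>2 + z)" by (simp add: power2_eq_square algebra_simps)
      then show ?thesis by presburger
    qed
    have "odd (?m\<^sup>2)" "odd (?m * (?m - 2))" "odd (?m\<^sup>2 - 8 * ?m + 12)" using 3 by simp_all
    then obtain u1 u4 where u: "odd u4" "?D 1 = ((?m\<^sup>2)\<^sup>2 - (?m * (?m - 2))\<^sup>2) * 2 ^ e * u1"
      "?D 4 = ((?m\<^sup>2)\<^sup>2 - (?m\<^sup>2 - 8 * ?m + 12)\<^sup>2) * 2 ^ e * u4"
      unfolding ev s(1) power_mult using e sq by metis
    have D1: "(?m\<^sup>2)\<^sup>2 - (?m * (?m - 2))\<^sup>2 = 8 * (?m\<^sup>2 * n)"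
      by (simp add: n power2_eq_square algebra_simps)
    have D4: "(?m\<^sup>2)\<^sup>2 - (?m\<^sup>2 - 8 * ?m + 12)\<^sup>2 = 8 * ((2 * ?m - 3) * (?m\<^sup>2 - 4 * ?m + 6))"
      by (simp add: power2_eq_square algebra_simps)
    have "8 * 2 ^ e * (k * ((2 * ?m - 3) * (?m\<^sup>2 - 4 * ?m + 6) * u4))
        = 8 * 2 ^ e * (l * (?m\<^sup>2 * n * u1))"
      using kl(1) unfolding u(2,3) D1 D4 by (simp only: mult_ac)
    then have "k * ((2 * ?m - 3) * (?m\<^sup>2 - 4 * ?m + 6) * u4) = l * (?m\<^sup>2 * n * u1)"
      by simp
    moreover have "odd (k * ((2 * ?m - 3) * (?m\<^sup>2 - 4 * ?m + 6) * u4))" "even (l * (?m\<^sup>2 * n * u1))"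
      using kl u 3 by auto
    ultimately show False by simp
  qed
qed

section \<open>Transfer times for \<open>K_2\<close> and \<open>J(6,3)\<close>\<close>

lemma phase_condition_1_lower_bound:
  assumes "0 < \<tau>" "1 \<le> r" "phase_condition 1 r \<tau> 1"
  shows "odd r \<and> pi / 2 \<le> \<tau>"
proof -
  obtain k :: int where k: "\<tau> * of_int (1 - (-1) ^ r) = of_int k * pi" "odd k"
    using assms(3) by (auto simp: phase_condition_def johnson_eigval_def)
  \<comment> \<open>The eigenvalues of \<open>K_2\<close> are 1 and -1; for even \<open>r\<close>
    their powers agree, which would force \<open>k = 0\<close>.\<close>
  have "odd r" using k by (cases "even r") auto
  then have "2 * \<tau> = of_int k * pi" using k(1) by simp
  moreover from this have "0 < of_int k * pi" using assms(1) by linarith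
  then have "1 \<le> k" by (simp add: zero_less_mult_iff)
  then have "1 * pi \<le> of_int k * pi" by (intro mult_right_mono) auto
  ultimately show ?thesis using \<open>odd r\<close> by linarith
qed

lemma johnson_eigval_3:
  "johnson_eigval 3 0 = 9" "johnson_eigval 3 (Suc 0) = 3" "johnson_eigval 3 2 = - 1" "johnson_eigval 3 3 = - 3"
  by (simp_all add: johnson_eigval_def)

lemma power_9: "(9::'a::comm_ring_1) ^ r = 3 ^ r * 3 ^ r"
  using power_mult_distrib[of "3::'a" 3 r] by simp

text \<open>With \<open>q = 3 ^ r\<close> the differences for \<open>j = 1\<close> and
  \<open>j = 2\<close> are \<open>q^2 - q\<close> and \<open>q^2 - 1\<close>. Subtracting them shows
  that \<open>\<tau> * (q - 1)\<close> is a positive integer multiple of \<open>pi\<close>.\<close>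

lemma phase_condition_3_lower_bound:
  assumes "0 < \<tau>" "1 \<le> r" "even r" "phase_condition 3 r \<tau> 1" "phase_condition 3 r \<tau> 2"
  shows "pi / (3 ^ r - 1) \<le> \<tau>"
proof -
  define q :: real where "q = 3 ^ r"
  have q: "1 < q" unfolding q_def using assms(2) by (intro one_less_power) auto
  obtain k l :: int where k: "\<tau> * (q * q - q) = of_int k * pi" and l: "\<tau> * (q * q - 1) = of_int l * pi"
    using assms(3-5) by (auto simp: phase_condition_def johnson_eigval_3 q_def power_9)
  have eq: "\<tau> * (q - 1) = of_int (l - k) * pi" using k l by (simp add: algebra_simps)
  have "0 < \<tau> * (q - 1)" using assms(1) q by simp
  then have "1 \<le> l - k" unfolding eq by (simp add: zero_less_mult_iff)
  then have "1 * pi \<le> of_int (l - k) * pi" by (intro mult_right_mono) (auto simp del: of_int_diff)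
  then have "pi \<le> \<tau> * (q - 1)" unfolding eq by simp
  then show ?thesis using q by (simp add: q_def[symmetric] pos_divide_le_eq)
qed

text \<open>Dividing the eigenvalue power differences by \<open>q - 1\<close> gives 0,
  \<open>q\<close>, \<open>q + 1\<close>, \<open>q\<close>; since \<open>q\<close> is odd, these
  have the parities of \<open>j\<close>.\<close>

lemma phase_condition_3:
  assumes "1 \<le> r" "even r" "j \<le> 3"
  shows "phase_condition 3 r (pi / (3 ^ r - 1)) j"
proof -
  define q :: int where "q = 3 ^ r"
  have "1 < q" unfolding q_def using assms(1) by (intro one_less_power) auto
  then have q: "real_of_int q - 1 > 0" by simp
  have qr: "(3::real) ^ r = of_int q" by (simp add: q_def)
  have odd: "odd q" by (simp add: q_def)
  have *: "phase_condition 3 r (pi / (3 ^ r - 1)) i"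
    if "johnson_eigval 3 0 ^ r - johnson_eigval 3 i ^ r = k * (q - 1)" "even k \<longleftrightarrow> even i" for i k
    unfolding phase_condition_def using that q by (intro exI[of _ k]) (simp add: qr)
  consider "j = 0" | "j = 1" | "j = 2" | "j = 3" using assms(3) by linarith
  then show ?thesis
  proof cases
    case 1 then show ?thesis by (intro *[of _ 0]) auto
  next
    case 2 then show ?thesis using odd
      by (intro *[of _ q]) (simp_all add: johnson_eigval_3 power_9 q_def algebra_simps)
  next
    case 3 then show ?thesis using odd assms(2)
      by (intro *[of _ "q + 1"]) (simp_all add: johnson_eigval_3 power_9 q_def algebra_simps)
  next
    case 4 then show ?thesis using odd assms(2)
      by (intro *[of _ q]) (simp_all add: johnson_eigval_3 power_9 q_def algebra_simps)
  qed
qed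

lemma johnson_2_1_pst_at:
  assumes "finite S" "card S = 2" "a \<in> johnson_verts S 1" "odd r"
  shows "pst_at (johnson_verts S 1)
    (fin_mat_pow (johnson_verts S 1) (johnson_matrix 1) r) a (S - a) (pi / 2)"
\<comment> \<open>The point mass is \<open>(1 + t) / 2\<close> at \<open>t = 1\<close> and
  \<open>t = -1\<close>.\<close>
proof (rule johnson_pst_at_complement[where \<alpha> = "\<lambda>_. 1 / 2"])
  fix j :: nat assume "j \<le> 1"
  then consider "j = 0" | "j = 1" by linarith
  then show "phase_condition 1 r (pi / 2) j"
  proof cases
    case 1 then show ?thesis by (auto simp: phase_condition_def intro: exI[of _ 0])
  next
    case 2 then show ?thesis using assms(4)
      by (auto simp: phase_condition_def johnson_eigval_def intro!: exI[of _ 1])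
  qed
next
  fix k :: nat assume "k \<le> 1"
  then consider "k = 0" | "k = 1" by linarith
  then show "(\<Sum>j\<le>1. 1 / 2 * zonal_poly 1 j (2 * real k - real 1)) = (if k = 1 then 1 else 0)"
    by cases (simp_all add: zonal_poly_def Let_def)
qed (use assms in auto)

lemma johnson_6_3_pst_at:
  assumes "finite S" "card S = 6" "a \<in> johnson_verts S 3" "1 \<le> r" "even r"
  shows "pst_at (johnson_verts S 3)
    (fin_mat_pow (johnson_verts S 3) (johnson_matrix 3) r) a (S - a) (pi / (3 ^ r - 1))"
\<comment> \<open>Multiplied by the values 1, 3, 36, 36 of the polynomials at \<open>t = 3\<close>,
  the coefficients become 1/20, 5/20, 9/20, 5/20: the eigenspace dimensions over the number of
  vertices.\<close>
proof (rule johnson_pst_at_complement[where \<alpha> = "(!) [1 / 20, 1 / 12, 1 / 80, 1 / 144]"])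
  have "(1::real) < 3 ^ r" using assms(4) by (intro one_less_power) auto
  then show "0 < pi / (3 ^ r - 1)" by simp
  show "phase_condition 3 r (pi / (3 ^ r - 1)) j" if "j \<le> 3" for j
    using phase_condition_3 assms that by blast
next
  fix k :: nat assume "k \<le> 3"
  then consider "k = 0" | "k = 1" | "k = 2" | "k = 3" by linarith
  moreover have "{..3::nat} = {0, 1, 2, 3}" by auto
  ultimately show "(\<Sum>j\<le>3. [1 / 20, 1 / 12, 1 / 80, 1 / 144] ! j * zonal_poly 3 j (2 * real k - real 3))
      = (if k = 3 then 1 else 0)"
    by cases (simp_all add: zonal_poly_def Let_def)
qed (use assms in auto)

section \<open>The classification and the minimum times\<close>

theorem theorem5p15:
  fixes S :: "'a set" and v m r :: nat
    and V :: "'a set set" and K :: "'a set \<Rightarrow> 'a set \<Rightarrow> real"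
  assumes "finite S" and "card S = v"
    and "1 \<le> m" and "2 * m \<le> v"
    and "1 \<le> r"
    and "V = johnson_verts S m"
    and "K = fin_mat_pow V (johnson_matrix m) r"
  shows "\<forall>a\<in>V. \<forall>b\<in>V. a \<noteq> b \<longrightarrow>
       (pst V K a b \<longleftrightarrow>
          (v = 2 \<and> m = 1 \<and> odd r) \<or>
          (v = 6 \<and> m = 3 \<and> even r \<and> b = S - a)) \<and>
       (v = 2 \<and> m = 1 \<and> odd r \<longrightarrow> is_min_transfer_time V K a b (pi / 2)) \<and>
       (v = 6 \<and> m = 3 \<and> even r \<and> b = S - a \<longrightarrow>
          is_min_transfer_time V K a b (pi / (3 ^ r - 1)))"
proof (intro ballI impI)
  fix a b assume a: "a \<in> V" and b: "b \<in> V" and "a \<noteq> b"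
  have aS: "a \<subseteq> S" "b \<subseteq> S" "card a = m" "card b = m" "finite a" "finite b"
    using a b assms(1) by (auto simp: assms(6) johnson_verts_def intro: finite_subset)
  \<comment> \<open>The bounds on \<tau> are proved together with the exclusions, so that minimality
    below follows from the same fact.\<close>
  have necessary: "b = S - a" "v = 2 * m" "m = 1 \<and> odd r \<and> pi / 2 \<le> \<tau> \<or>
      m = 3 \<and> even r \<and> pi / (3 ^ r - 1) \<le> \<tau>" if pst: "pst_at V K a b \<tau>" for \<tau>
  proof -
    show ba: "b = S - a"
      using johnson_pst_complement assms a b \<open>a \<noteq> b\<close> pst by blast
    then show v: "v = 2 * m" using aS assms by (auto simp: card_Diff_subset)
    have "0 < \<tau>" using pst by (simp add: pst_at_def)
    have phase: "phase_condition m r \<tau> j" if "j \<le> 4" "j \<le> m" for j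
      using johnson_pst_imp_phase_condition[OF assms(1) _ assms(3) _ _ that] pst ba v a assms by simp
    show "m = 1 \<and> odd r \<and> pi / 2 \<le> \<tau> \<or> m = 3 \<and> even r \<and> pi / (3 ^ r - 1) \<le> \<tau>"
    proof (cases "m = 1")
      case True
      then show ?thesis
        using phase_condition_1_lower_bound[OF \<open>0 < \<tau>\<close> assms(5)] phase[of 1] by simp
    next
      case False
      then have "m = 3 \<and> even r"
        using phase_conditions_contradictory[of m r \<tau>] phase assms(3,5) by fastforce
      then show ?thesis
        using phase_condition_3_lower_bound[OF \<open>0 < \<tau>\<close> assms(5)] phase[of 1] phase[of 2] by simp
    qed
  qed
  have K2: "is_min_transfer_time V K a b (pi / 2)" if vm: "v = 2 \<and> m = 1 \<and> odd r"
  proof -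
    \<comment> \<open>Distinct singletons in a 2-element set are complementary, which is why case
      (i) puts no condition on \<open>b\<close>.\<close>
    have "a \<inter> b = {}" using vm aS \<open>a \<noteq> b\<close> by (auto simp: card_1_singleton_iff)
    then have "b \<subseteq> S - a" using aS by blast
    moreover have "card (S - a) = card b" using vm aS assms by (simp add: card_Diff_subset)
    ultimately have "b = S - a" using assms(1) by (metis card_subset_eq finite_Diff)
    then have "pst_at V K a b (pi / 2)"
      using johnson_2_1_pst_at[of S a r] vm a assms by simp
    then show ?thesis using necessary(3) vm unfolding is_min_transfer_time_def by force
  qed
  have J63: "is_min_transfer_time V K a b (pi / (3 ^ r - 1))"
    if vm: "v = 6 \<and> m = 3 \<and> even r \<and> b = S - a"
  proof -
    have "pst_at V K a b (pi / (3 ^ r - 1))"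
      using johnson_6_3_pst_at[of S a r] vm a assms by simp
    then show ?thesis using necessary(3) vm unfolding is_min_transfer_time_def by force
  qed
  have "v = 2 \<and> m = 1 \<and> odd r \<or> v = 6 \<and> m = 3 \<and> even r \<and> b = S - a" if ab: "pst V K a b"
  proof -
    obtain \<tau> where "pst_at V K a b \<tau>" using ab unfolding pst_def by blast
    from necessary[OF this] show ?thesis by auto
  qed
  moreover have "pst V K a b" if "is_min_transfer_time V K a b \<tau>" for \<tau>
    using that unfolding is_min_transfer_time_def pst_def by blast
  ultimately show "(pst V K a b \<longleftrightarrow>
          (v = 2 \<and> m = 1 \<and> odd r) \<or>
          (v = 6 \<and> m = 3 \<and> even r \<and> b = S - a)) \<and>
       (v = 2 \<and> m = 1 \<and> odd r \<longrightarrow> is_min_transfer_time V K a b (pi / 2)) \<and>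
       (v = 6 \<and> m = 3 \<and> even r \<and> b = S - a \<longrightarrow>
          is_min_transfer_time V K a b (pi / (3 ^ r - 1)))"
    using K2 J63 by blast
qed

end
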